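(* Consider the double linear policy with pair $(\alpha,w)$ in the market model described in the context, with transaction cost rate $\varepsilon\in[0,1]$, and let $\overline{\mathcal{G}}_k(\alpha,w,\mu,\varepsilon)=\mathbb{E}[V(k)-V_0]$ be the expected cumulative trading gain-loss up to stage $k$. For all integers $k>1$, the following statements hold. (i) If $\varepsilon=0$, then for $\alpha=1/2$ and any $w\in\mathcal{W}\setminus\{0\}$ we have $\overline{\mathcal{G}}_k(1/2,w,\mu,\varepsilon)>0$ whenever $\mu\neq 0$. Moreover, if $\mu=0$, then $\overline{\mathcal{G}}_k(1/2,w,\mu,\varepsilon)=0$. (ii) If $\varepsilon>0$, then for any $\alpha\in(0,1)$ and any $w\in\mathcal{W}\setminus\{0\}$ we have $\overline{\mathcal{G}}_k(\alpha,w,\mu,\varepsilon)>0$ whenever $\mu>\mu_+$ or $\mu<\mu_-$, where $$\mu_+=\frac{1}{w}\left(e^{\frac1k\log\frac1\alpha}-1\right)+\varepsilon,\qquad \mu_-=\frac{1}{w}\left(1-e^{\frac1k\log\frac{1}{1-\alpha}}\right)-\varepsilon.$$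
   Context: Market model: an asset has prices $S(k)>0$, $k=0,1,2,\dots$, and per-period returns $X(k)=\frac{S(k+1)-S(k)}{S(k)}$. The returns $X(0),X(1),\dots$ are independent random variables (with arbitrary distributions) with common mean $\mathbb{E}[X(k)]=\mu$ and common variance $\mathrm{var}(X(k))=\sigma^2\ge 0$, and almost surely $X_{\min}\le X(k)\le X_{\max}$ for all $k$, where $-1<X_{\min}<0<X_{\max}<\infty$ are known constants lying in the support of $X(k)$. Double linear policy: let $V_0>0$ be the initial account value, $\alpha\in[0,1]$ an allocation constant, $\varepsilon\in[0,1]$ the transaction cost rate, and $w\in\mathcal{W}:=[0,w_{\max}]$ with $w_{\max}:=\min\left\{\frac{1}{1+\varepsilon},\frac{1}{X_{\max}+\varepsilon}\right\}$. Set $V_L(0)=\alpha V_0$ and $V_S(0)=(1-\alpha)V_0$, and define the policy by $\pi_L(k)=wV_L(k)$, $\pi_S(k)=-wV_S(k)$. The long and short account values evolve by $$V_L(k+1)=V_L(k)+X(k)\pi_L(k)-\varepsilon\pi_L(k),\qquad V_S(k+1)=V_S(k)+X(k)\pi_S(k)-\varepsilon|\pi_S(k)|,$$ where the short-side cost is $\varepsilon|\pi_S(k)|=\varepsilon wV_S(k)$. The overall account value is $V(k)=V_L(k)+V_S(k)$; explicitly $$V(k)=V_0\left(\alpha\prod_{j=0}^{k-1}\bigl(1+w(X(j)-\varepsilon)\bigr)+(1-\alpha)\prod_{j=0}^{k-1}\bigl(1-w(X(j)+\varepsilon)\bigr)\right).$$ *)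

theory Defs
  imports "HOL-Probability.Probability"
begin

definition measure_support :: "'b::topological_space measure \<Rightarrow> 'b set" where
  "measure_support N = {x. \<forall>U. open U \<longrightarrow> x \<in> U \<longrightarrow> emeasure N U > 0}"

definition asset_return :: "(nat \<Rightarrow> 'a \<Rightarrow> real) \<Rightarrow> nat \<Rightarrow> 'a \<Rightarrow> real" where
  "asset_return S k \<omega> = (S (Suc k) \<omega> - S k \<omega>) / S k \<omega>"

locale market_model = prob_space M
  for M :: "'a measure" +
  fixes S :: "nat \<Rightarrow> 'a \<Rightarrow> real" and \<mu> \<sigma> X_min X_max :: real
  assumes price_measurable: "\<And>k. random_variable borel (S k)"
    and price_pos: "\<And>k \<omega>. \<omega> \<in> space M \<Longrightarrow> S k \<omega> > 0"
    and returns_indep: "indep_vars (\<lambda>_. borel) (asset_return S) UNIV"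
    and returns_mean: "\<And>k. expectation (asset_return S k) = \<mu>"
    and returns_variance: "\<And>k. variance (asset_return S k) = \<sigma>\<^sup>2"
    and returns_bounds: "AE \<omega> in M. \<forall>k. X_min \<le> asset_return S k \<omega> \<and> asset_return S k \<omega> \<le> X_max"
    and X_min_range: "- 1 < X_min" "X_min < 0"
    and X_max_pos: "0 < X_max"
    and X_min_support: "\<And>k. X_min \<in> measure_support (distr M borel (asset_return S k))"
    and X_max_support: "\<And>k. X_max \<in> measure_support (distr M borel (asset_return S k))"

definition w_max :: "real \<Rightarrow> real \<Rightarrow> real" where
  "w_max X_max \<epsilon> = min (1 / (1 + \<epsilon>)) (1 / (X_max + \<epsilon>))"

definition admissible_weights :: "real \<Rightarrow> real \<Rightarrow> real set" where
  "admissible_weights X_max \<epsilon> = {0..w_max X_max \<epsilon>}"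

text \<open>Long and short positions as functions of the current account value; the short
  position is negative.\<close>

definition long_policy :: "real \<Rightarrow> real \<Rightarrow> real" where
  "long_policy w v = w * v"

definition short_policy :: "real \<Rightarrow> real \<Rightarrow> real" where
  "short_policy w v = - w * v"

text \<open>Account values along a single return path \<open>x\<close>.\<close>

primrec long_value :: "real \<Rightarrow> real \<Rightarrow> real \<Rightarrow> real \<Rightarrow> (nat \<Rightarrow> real) \<Rightarrow> nat \<Rightarrow> real" where
  "long_value V0 \<alpha> w \<epsilon> x 0 = \<alpha> * V0"
| "long_value V0 \<alpha> w \<epsilon> x (Suc k) =
     long_value V0 \<alpha> w \<epsilon> x k
     + x k * long_policy w (long_value V0 \<alpha> w \<epsilon> x k)
     - \<epsilon> * long_policy w (long_value V0 \<alpha> w \<epsilon> x k)"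

primrec short_value :: "real \<Rightarrow> real \<Rightarrow> real \<Rightarrow> real \<Rightarrow> (nat \<Rightarrow> real) \<Rightarrow> nat \<Rightarrow> real" where
  "short_value V0 \<alpha> w \<epsilon> x 0 = (1 - \<alpha>) * V0"
| "short_value V0 \<alpha> w \<epsilon> x (Suc k) =
     short_value V0 \<alpha> w \<epsilon> x k
     + x k * short_policy w (short_value V0 \<alpha> w \<epsilon> x k)
     - \<epsilon> * \<bar>short_policy w (short_value V0 \<alpha> w \<epsilon> x k)\<bar>"

definition account_value :: "real \<Rightarrow> real \<Rightarrow> real \<Rightarrow> real \<Rightarrow> (nat \<Rightarrow> real) \<Rightarrow> nat \<Rightarrow> real" where
  "account_value V0 \<alpha> w \<epsilon> x k = long_value V0 \<alpha> w \<epsilon> x k + short_value V0 \<alpha> w \<epsilon> x k"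

text \<open>The mean return does not occur as an argument here: it enters through the law of \<open>S\<close>
  under \<open>M\<close>.\<close>

definition expected_gain ::
  "'a measure \<Rightarrow> (nat \<Rightarrow> 'a \<Rightarrow> real) \<Rightarrow> real \<Rightarrow> nat \<Rightarrow> real \<Rightarrow> real \<Rightarrow> real \<Rightarrow> real" where
  "expected_gain M S V0 k \<alpha> w \<epsilon> =
     prob_space.expectation M (\<lambda>\<omega>. account_value V0 \<alpha> w \<epsilon> (\<lambda>j. asset_return S j \<omega>) k - V0)"

definition mu_plus :: "nat \<Rightarrow> real \<Rightarrow> real \<Rightarrow> real \<Rightarrow> real" where
  "mu_plus k \<alpha> w \<epsilon> = 1 / w * (exp (1 / real k * ln (1 / \<alpha>)) - 1) + \<epsilon>"

definition mu_minus :: "nat \<Rightarrow> real \<Rightarrow> real \<Rightarrow> real \<Rightarrow> real" where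
  "mu_minus k \<alpha> w \<epsilon> = 1 / w * (1 - exp (1 / real k * ln (1 / (1 - \<alpha>)))) - \<epsilon>"

lemma long_value_eq:
  "long_value V0 \<alpha> w \<epsilon> x k = \<alpha> * V0 * (\<Prod>j<k. 1 + w * (x j - \<epsilon>))"
  by (induction k) (simp_all add: long_policy_def algebra_simps)

lemma short_value_eq:
  assumes "\<epsilon> \<ge> 0" "w \<in> admissible_weights X_max \<epsilon>" "0 < X_max" "V0 > 0" "\<alpha> \<le> 1"
    and "\<And>j. x j \<le> X_max"
  shows "short_value V0 \<alpha> w \<epsilon> x k = (1 - \<alpha>) * V0 * (\<Prod>j<k. 1 - w * (x j + \<epsilon>))
    \<and> short_value V0 \<alpha> w \<epsilon> x k \<ge> 0"
proof (induction k)
  case 0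
  show ?case using assms by simp
next
  case (Suc k)
  have w: "0 \<le> w" "w \<le> 1 / (X_max + \<epsilon>)"
    using assms(2) by (auto simp: admissible_weights_def w_max_def)
  have "w * (x k + \<epsilon>) \<le> w * (X_max + \<epsilon>)"
    using w(1) assms(6)[of k] by (intro mult_left_mono) auto
  also have "\<dots> \<le> 1"
    using w(2) assms(1,3) by (simp add: field_simps)
  finally have f: "0 \<le> 1 - w * (x k + \<epsilon>)" by simp
  have "\<bar>short_policy w (short_value V0 \<alpha> w \<epsilon> x k)\<bar> = w * short_value V0 \<alpha> w \<epsilon> x k"
    using conjunct2[OF Suc] w(1) by (simp only: short_policy_def abs_mult abs_minus_cancel abs_of_nonneg)
  then have e: "short_value V0 \<alpha> w \<epsilon> x (Suc k)
      = short_value V0 \<alpha> w \<epsilon> x k * (1 - w * (x k + \<epsilon>))"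
    by (simp add: short_policy_def algebra_simps)
  then show ?case using Suc f by (simp only: e) (simp add: mult_nonneg_nonneg)
qed

end

theory Submission
  imports Defs
begin

text \<open>By independence the expected account value is
  \<open>V0 * (\<alpha> * A ^ k + (1 - \<alpha>) * B ^ k)\<close> with \<open>A = 1 + w * (\<mu> - \<epsilon>)\<close> and
  \<open>B = 1 - w * (\<mu> + \<epsilon>)\<close>, and admissibility of \<open>w\<close> makes both \<open>A\<close> and \<open>B\<close>
  nonnegative. Without costs, \<open>A = 1 + t\<close> and \<open>B = 1 - t\<close>, and \<open>A ^ k + B ^ k > 2\<close> by strict
  convexity. With costs, each threshold is exactly the condition under which one of the two
  nonnegative summands alone exceeds \<open>1\<close>.\<close>

text \<open>Raising the exponent from \<open>n\<close> to \<open>Suc n\<close> adds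
  \<open>t * ((1 + t) ^ n - (1 - t) ^ n)\<close> to the sum. Both bases are nonnegative, so the
  difference of powers never has the sign opposite to \<open>t\<close>.\<close>

lemma power_one_plus_minus_sum_ge:
  fixes t :: real
  assumes "\<bar>t\<bar> \<le> 1"
  shows "(1 + t) ^ n + (1 - t) ^ n \<ge> 2"
proof (induction n)
  case (Suc n)
  have "t * ((1 + t) ^ n - (1 - t) ^ n) \<ge> 0"
  proof (cases "t \<ge> 0")
    case True
    then have "(1 - t) ^ n \<le> (1 + t) ^ n" using assms by (intro power_mono) auto
    with True show ?thesis by simp
  next
    case False
    then have "(1 + t) ^ n \<le> (1 - t) ^ n" using assms by (intro power_mono) auto
    with False show ?thesis by (intro mult_nonpos_nonpos) auto
  qed
  with Suc show ?case by (simp add: algebra_simps)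
qed simp

text \<open>The last increment, taken at exponent \<open>m = n - 1 > 0\<close>, is strictly
  positive; the weak bound covers the earlier ones. At \<open>n = 1\<close> the sum equals 2, so
  strictness starts at 2.\<close>

lemma power_one_plus_minus_sum_gt:
  fixes t :: real
  assumes "\<bar>t\<bar> \<le> 1" "t \<noteq> 0" "n > 1"
  shows "(1 + t) ^ n + (1 - t) ^ n > 2"
proof -
  obtain m where n: "n = Suc m" "m > 0" using assms(3) by (cases n) auto
  have "t * ((1 + t) ^ m - (1 - t) ^ m) > 0"
  proof (cases "t \<ge> 0")
    case True
    then have "(1 - t) ^ m < (1 + t) ^ m" using assms n by (intro power_strict_mono) auto
    with True assms(2) show ?thesis by simp
  next
    case False
    then have "(1 + t) ^ m < (1 - t) ^ m" using assms n by (intro power_strict_mono) auto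
    with False show ?thesis by (intro mult_neg_neg) auto
  qed
  with power_one_plus_minus_sum_ge[OF assms(1), of m] show ?thesis
    by (simp add: n algebra_simps)
qed

text \<open>The exponential is the \<open>k\<close>-th root of \<open>1 / a\<close>.\<close>

lemma mult_power_gt_one:
  fixes a b :: real
  assumes "0 < a" "0 < k" "exp (1 / real k * ln (1 / a)) < b"
  shows "1 < a * b ^ k"
proof -
  have "1 / a = exp (1 / real k * ln (1 / a)) ^ k"
    using assms(1,2) by (simp flip: exp_of_nat_mult)
  also have "\<dots> < b ^ k"
    using assms(2,3) by (intro power_strict_mono) auto
  finally show ?thesis using assms(1) by (simp add: field_simps)
qed

text \<open>Each term of the minimum in \<open>w_max\<close> guards one factor:
  \<open>1 / (1 + \<epsilon>)\<close> the long one, at worst \<open>m = - 1\<close>, and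
  \<open>1 / (X_max + \<epsilon>)\<close> the short one, at worst \<open>m = X_max\<close>.\<close>

lemma admissible_weights_factor_bounds:
  assumes "w \<in> admissible_weights X_max \<epsilon>" "0 \<le> \<epsilon>" "0 < X_max" "- 1 \<le> m" "m \<le> X_max"
  shows "0 \<le> 1 + w * (m - \<epsilon>)" "0 \<le> 1 - w * (m + \<epsilon>)"
proof -
  have w: "0 \<le> w" "w \<le> 1 / (1 + \<epsilon>)" "w \<le> 1 / (X_max + \<epsilon>)"
    using assms(1) by (auto simp: admissible_weights_def w_max_def)
  have "w * (\<epsilon> - m) \<le> w * (1 + \<epsilon>)"
    using w(1) assms(4) by (intro mult_left_mono) auto
  also have "\<dots> \<le> 1" using w(2) assms(2) by (simp add: field_simps)
  finally show "0 \<le> 1 + w * (m - \<epsilon>)" by (simp add: algebra_simps)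
  have "w * (m + \<epsilon>) \<le> w * (X_max + \<epsilon>)"
    using w(1) assms(5) by (intro mult_left_mono) auto
  also have "\<dots> \<le> 1" using w(3) assms(2,3) by (simp add: field_simps)
  finally show "0 \<le> 1 - w * (m + \<epsilon>)" by simp
qed

context market_model
begin

lemma returns_measurable [measurable]: "asset_return S j \<in> borel_measurable M"
  using returns_indep by (auto simp: indep_vars_def)

lemma AE_return_bounds:
  "AE \<omega> in M. X_min \<le> asset_return S j \<omega>" "AE \<omega> in M. asset_return S j \<omega> \<le> X_max"
  using returns_bounds by (auto elim: eventually_mono)

lemma returns_integrable: "integrable M (asset_return S j)"
proof (rule integrable_const_bound)
  show "AE \<omega> in M. norm (asset_return S j \<omega>) \<le> max \<bar>X_min\<bar> \<bar>X_max\<bar>"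
    using returns_bounds by eventually_elim (smt (verit) real_norm_def)
qed simp

lemma mean_bounds: "X_min \<le> \<mu>" "\<mu> \<le> X_max"
proof -
  show "X_min \<le> \<mu>"
    using integral_ge_const[OF returns_integrable AE_return_bounds(1), of 0] returns_mean by simp
  show "\<mu> \<le> X_max"
    using integral_le_const[OF returns_integrable AE_return_bounds(2), of 0] returns_mean by simp
qed

text \<open>Independence lets the expectation pass through the product. With \<open>b = w\<close>
  and \<open>b = - w\<close> this serves both the long and the short side.\<close>

lemma affine_return_product:
  shows "integrable M (\<lambda>\<omega>. \<Prod>j<k. a + b * asset_return S j \<omega>)" (is ?int)
    and "expectation (\<lambda>\<omega>. \<Prod>j<k. a + b * asset_return S j \<omega>) = (a + b * \<mu>) ^ k" (is ?exp)
proof -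
  have ind: "indep_vars (\<lambda>_. borel) (\<lambda>j \<omega>. a + b * asset_return S j \<omega>) {..<k}"
    by (rule indep_vars_compose2[OF indep_vars_subset[OF returns_indep]]) auto
  have int: "integrable M (\<lambda>\<omega>. a + b * asset_return S j \<omega>)" for j
    using returns_integrable by simp
  show ?int
    by (rule indep_vars_integrable[OF _ ind]) (simp_all add: int)
  have "expectation (\<lambda>\<omega>. \<Prod>j<k. a + b * asset_return S j \<omega>)
      = (\<Prod>j<k. expectation (\<lambda>\<omega>. a + b * asset_return S j \<omega>))"
    by (rule indep_vars_lebesgue_integral[OF _ ind]) (simp_all add: int)
  also have "\<dots> = (a + b * \<mu>) ^ k"
    using returns_integrable returns_mean by (simp add: prob_space)
  finally show ?exp .
qed

lemma expected_gain_eq: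
  assumes "V0 > 0" "0 \<le> \<epsilon>" "\<alpha> \<le> 1" "w \<in> admissible_weights X_max \<epsilon>"
  shows "expected_gain M S V0 k \<alpha> w \<epsilon>
    = V0 * (\<alpha> * (1 + w * (\<mu> - \<epsilon>)) ^ k + (1 - \<alpha>) * (1 - w * (\<mu> + \<epsilon>)) ^ k - 1)"
proof -
  let ?R = "\<lambda>\<omega> j. asset_return S j \<omega>"
  let ?L = "\<lambda>\<omega>. \<Prod>j<k. (1 - w * \<epsilon>) + w * ?R \<omega> j"
  let ?T = "\<lambda>\<omega>. \<Prod>j<k. (1 - w * \<epsilon>) + (- w) * ?R \<omega> j"
  let ?V = "\<lambda>\<omega>. \<alpha> * V0 * ?L \<omega> + (1 - \<alpha>) * V0 * ?T \<omega> - V0"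
  \<comment> \<open>The closed form of the short side rests on the upper return bound, which
    resolves the absolute value in the cost; hence it is available only almost surely.\<close>
  have eq: "account_value V0 \<alpha> w \<epsilon> (?R \<omega>) k - V0 = ?V \<omega>"
    if "\<forall>j. X_min \<le> ?R \<omega> j \<and> ?R \<omega> j \<le> X_max" for \<omega>
  proof -
    have "short_value V0 \<alpha> w \<epsilon> (?R \<omega>) k = (1 - \<alpha>) * V0 * (\<Prod>j<k. 1 - w * (?R \<omega> j + \<epsilon>))"
      using short_value_eq[OF assms(2,4) X_max_pos assms(1,3), of "?R \<omega>"] that by simp
    then show ?thesis
      by (simp add: account_value_def long_value_eq algebra_simps)
  qed
  \<comment> \<open>\<open>integral_cong_AE\<close> asks for measurability on the whole space, so it
    is derived from the recursion instead of the closed form.\<close>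
  have meas: "(\<lambda>\<omega>. long_value V0 \<alpha> w \<epsilon> (?R \<omega>) i) \<in> borel_measurable M"
    "(\<lambda>\<omega>. short_value V0 \<alpha> w \<epsilon> (?R \<omega>) i) \<in> borel_measurable M" for i
    by (induction i) (simp_all add: long_policy_def short_policy_def)
  have "expected_gain M S V0 k \<alpha> w \<epsilon> = expectation ?V"
    unfolding expected_gain_def
  proof (rule integral_cong_AE)
    show "(\<lambda>\<omega>. account_value V0 \<alpha> w \<epsilon> (?R \<omega>) k - V0) \<in> borel_measurable M"
      unfolding account_value_def using meas by measurable
    show "AE \<omega> in M. account_value V0 \<alpha> w \<epsilon> (?R \<omega>) k - V0 = ?V \<omega>"
      using returns_bounds by (rule eventually_mono) (rule eq)
  qed measurable
  also have "\<dots> = \<alpha> * V0 * expectation ?L + (1 - \<alpha>) * V0 * expectation ?T - V0"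
    using affine_return_product(1)[where k = k and a = "1 - w * \<epsilon>" and b = w]
      affine_return_product(1)[where k = k and a = "1 - w * \<epsilon>" and b = "- w"]
    \<comment> \<open>Keeping \<open>- w\<close> as a coefficient preserves the shape
      \<open>a + b * R\<close> of the integrand of \<open>?T\<close>.\<close>
    by (simp add: prob_space del: mult_minus_left)
  finally show ?thesis
    unfolding affine_return_product(2) by (simp add: algebra_simps)
qed

end

theorem mainTheorem1:
  fixes M :: "'a measure" and S :: "nat \<Rightarrow> 'a \<Rightarrow> real"
    and \<mu> \<sigma> X_min X_max V0 \<epsilon> :: real and k :: nat
  assumes "market_model M S \<mu> \<sigma> X_min X_max"
    and "V0 > 0"
    and "0 \<le> \<epsilon>" "\<epsilon> \<le> 1"
    and "k > 1"
  shows "(\<epsilon> = 0 \<longrightarrow>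
            (\<forall>w \<in> admissible_weights X_max \<epsilon> - {0}.
               (\<mu> \<noteq> 0 \<longrightarrow> expected_gain M S V0 k (1/2) w \<epsilon> > 0) \<and>
               (\<mu> = 0 \<longrightarrow> expected_gain M S V0 k (1/2) w \<epsilon> = 0)))
       \<and> (\<epsilon> > 0 \<longrightarrow>
            (\<forall>\<alpha> \<in> {0<..<1}. \<forall>w \<in> admissible_weights X_max \<epsilon> - {0}.
               (\<mu> > mu_plus k \<alpha> w \<epsilon> \<or> \<mu> < mu_minus k \<alpha> w \<epsilon>) \<longrightarrow>
               expected_gain M S V0 k \<alpha> w \<epsilon> > 0))"
proof -
  interpret market_model M S \<mu> \<sigma> X_min X_max by (rule assms(1))
  \<comment> \<open>The factor bounds are taken at the mean, which inherits the almost sure bounds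
    on the returns.\<close>
  have factors: "0 \<le> 1 + w * (\<mu> - \<epsilon>)" "0 \<le> 1 - w * (\<mu> + \<epsilon>)"
    if "w \<in> admissible_weights X_max \<epsilon>" for w
    using admissible_weights_factor_bounds[OF that assms(3) X_max_pos, of \<mu>]
      mean_bounds X_min_range by auto
  have costless: "(\<mu> \<noteq> 0 \<longrightarrow> expected_gain M S V0 k (1/2) w \<epsilon> > 0) \<and>
      (\<mu> = 0 \<longrightarrow> expected_gain M S V0 k (1/2) w \<epsilon> = 0)"
    if "\<epsilon> = 0" and w: "w \<in> admissible_weights X_max \<epsilon>" "w \<noteq> 0" for w
  proof -
    have gain: "expected_gain M S V0 k (1/2) w \<epsilon>
        = V0 * (((1 + w * \<mu>) ^ k + (1 - w * \<mu>) ^ k) / 2 - 1)"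
      using expected_gain_eq[OF assms(2,3) _ w(1), of "1/2" k] \<open>\<epsilon> = 0\<close>
      by (simp add: add_divide_distrib)
    \<comment> \<open>At zero cost the two factors are \<open>1 + w * \<mu>\<close> and
      \<open>1 - w * \<mu>\<close>; both being nonnegative is exactly this bound.\<close>
    have "\<bar>w * \<mu>\<bar> \<le> 1" using factors[OF w(1)] \<open>\<epsilon> = 0\<close> by (simp add: abs_le_iff)
    then have "(1 + w * \<mu>) ^ k + (1 - w * \<mu>) ^ k > 2" if "\<mu> \<noteq> 0"
      using that w(2) assms(5) by (intro power_one_plus_minus_sum_gt) auto
    then show ?thesis using assms(2) by (auto simp: gain)
  qed
  have costly: "expected_gain M S V0 k \<alpha> w \<epsilon> > 0"
    if \<alpha>: "0 < \<alpha>" "\<alpha> < 1" and w: "w \<in> admissible_weights X_max \<epsilon>" "w \<noteq> 0"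
      and \<mu>: "\<mu> > mu_plus k \<alpha> w \<epsilon> \<or> \<mu> < mu_minus k \<alpha> w \<epsilon>" for \<alpha> w
  proof -
    let ?A = "1 + w * (\<mu> - \<epsilon>)" and ?B = "1 - w * (\<mu> + \<epsilon>)"
    have "w > 0" using w by (auto simp: admissible_weights_def)
    have nonneg: "0 \<le> \<alpha> * ?A ^ k" "0 \<le> (1 - \<alpha>) * ?B ^ k"
      using \<alpha> factors[OF w(1)] by simp_all
    from \<mu> have "1 < \<alpha> * ?A ^ k + (1 - \<alpha>) * ?B ^ k"
    proof
      assume "\<mu> > mu_plus k \<alpha> w \<epsilon>"
      \<comment> \<open>Multiplying the threshold inequality by \<open>w > 0\<close> isolates the
        \<open>k\<close>-th root of \<open>1 / \<alpha>\<close>.\<close>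
      then have "exp (1 / real k * ln (1 / \<alpha>)) < ?A"
        using \<open>w > 0\<close> by (simp add: mu_plus_def field_simps)
      with \<alpha> assms(5) have "1 < \<alpha> * ?A ^ k" by (intro mult_power_gt_one) auto
      with nonneg show ?thesis by linarith
    next
      assume "\<mu> < mu_minus k \<alpha> w \<epsilon>"
      then have "exp (1 / real k * ln (1 / (1 - \<alpha>))) < ?B"
        using \<open>w > 0\<close> by (simp add: mu_minus_def field_simps)
      with \<alpha> assms(5) have "1 < (1 - \<alpha>) * ?B ^ k" by (intro mult_power_gt_one) auto
      with nonneg show ?thesis by linarith
    qed
    then show ?thesis
      using assms(2) \<alpha> by (simp add: expected_gain_eq[OF assms(2,3) _ w(1)])
  qed
  from costless costly show ?thesis by auto
qed

end
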